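(* Let $\nabla$ be a cl-connection on $\mathbb{R}^2$ determined by $(W,m,n)$, where $W=(\cos\theta_0,\sin\theta_0)$. Let $\gamma$ be a smooth curve parametrized by arc length, and let $\psi(s)$ be its relative angle function with respect to $W$. Then the tangential and geodesic curvatures of $\gamma$ with respect to $\nabla$ are $$\kappa_t(s)=(m+n)\cos\psi(s),$$ $$\kappa_g(s)=\sqrt{(\psi'(s)-n\sin\psi(s))^2+(\psi'(s)+m\sin\psi(s))^2},$$ where $m=m\circ\gamma$ and $n=n\circ\gamma$.
   Context: $\langle\cdot,\cdot\rangle$ is the Euclidean metric on $\mathbb{R}^2$ and $\nabla^0$ its Levi-Civita connection. Let $W$ be a constant unit vector field on $\mathbb{R}^2$ and let $m,n:\mathbb{R}^2\to\mathbb{R}$ be smooth functions, not both identically zero. The canonical linear connection (cl-connection) determined by $(W,m,n)$ is $$\nabla_XY=\nabla^0_XY+m\langle W,Y\rangle X+n\langle X,Y\rangle W .$$ For a smooth curve $\gamma$ parametrized by arc length, $T=\gamma'=(\cos\theta,\sin\theta)$ is the unit tangent ($\theta(s)$ a smooth angle function with respect to the positive $x$-axis), $N=(-\sin\theta,\cos\theta)$ the unit normal, and $\kappa=\theta'$ the (signed) Frenet curvature. With $m,n$ evaluated along $\gamma$, the tangential curvature is $\kappa_t=(m+n)\langle W,T\rangle$, and the geodesic curvature $\kappa_g\ge0$ is defined by $\kappa_g^2=(\kappa+n\langle W,N\rangle)^2+(m\langle W,N\rangle-\kappa)^2$. The relative angle function of $\gamma$ with respect to $W=(\cos\theta_0,\sin\theta_0)$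 is $\psi(s)=\theta(s)-\theta_0$. *)

theory Defs
  imports "HOL-Analysis.Analysis"
begin

type_synonym plane = "real^2"
type_synonym vfield = "plane \<Rightarrow> plane"

(* Derivatives are taken within S.  They are unique when S is open or is a nondegenerate
   interval of the line (one-sided derivatives at its end points); only such S are used below. *)
primrec Ck_on :: "nat \<Rightarrow> 'a set \<Rightarrow> ('a::real_normed_vector \<Rightarrow> 'b::real_normed_vector) \<Rightarrow> bool" where
  "Ck_on 0 S f \<longleftrightarrow> continuous_on S f"
| "Ck_on (Suc k) S f \<longleftrightarrow>
     f differentiable_on S \<and> (\<forall>v. Ck_on k S (\<lambda>x. frechet_derivative f (at x within S) v))"

definition smooth_on :: "'a set \<Rightarrow> ('a::real_normed_vector \<Rightarrow> 'b::real_normed_vector) \<Rightarrow> bool" where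
  "smooth_on S f \<longleftrightarrow> (\<forall>k. Ck_on k S f)"

(* The Levi-Civita connection of the Euclidean metric: in the standard coordinates its
   Christoffel symbols vanish, so it differentiates the components of Y in the direction X. *)
definition flat_connection :: "vfield \<Rightarrow> vfield \<Rightarrow> vfield" where
  "flat_connection X Y p = frechet_derivative Y (at p) (X p)"

definition cl_connection ::
    "(vfield \<Rightarrow> vfield \<Rightarrow> vfield) \<Rightarrow> plane \<Rightarrow> (plane \<Rightarrow> real) \<Rightarrow> (plane \<Rightarrow> real) \<Rightarrow> bool" where
  "cl_connection nabla W m n \<longleftrightarrow>
     norm W = 1 \<and> smooth_on UNIV m \<and> smooth_on UNIV n \<and>
     \<not> ((\<forall>p. m p = 0) \<and> (\<forall>p. n p = 0)) \<and>
     (\<forall>X Y. smooth_on UNIV X \<longrightarrow> smooth_on UNIV Y \<longrightarrow>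
        (\<forall>p. nabla X Y p = flat_connection X Y p
               + (m p * (W \<bullet> Y p)) *\<^sub>R X p + (n p * (X p \<bullet> Y p)) *\<^sub>R W))"

definition tangent :: "real set \<Rightarrow> (real \<Rightarrow> plane) \<Rightarrow> real \<Rightarrow> plane" where
  "tangent I \<gamma> s = vector_derivative \<gamma> (at s within I)"

definition arc_length_curve :: "real set \<Rightarrow> (real \<Rightarrow> plane) \<Rightarrow> bool" where
  "arc_length_curve I \<gamma> \<longleftrightarrow> smooth_on I \<gamma> \<and> (\<forall>s\<in>I. norm (tangent I \<gamma> s) = 1)"

definition angle_function :: "real set \<Rightarrow> (real \<Rightarrow> plane) \<Rightarrow> (real \<Rightarrow> real) \<Rightarrow> bool" where
  "angle_function I \<gamma> \<theta> \<longleftrightarrow>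
     smooth_on I \<theta> \<and> (\<forall>s\<in>I. tangent I \<gamma> s = vector [cos (\<theta> s), sin (\<theta> s)])"

definition normal :: "(real \<Rightarrow> real) \<Rightarrow> real \<Rightarrow> plane" where
  "normal \<theta> s = vector [- sin (\<theta> s), cos (\<theta> s)]"

definition frenet_curvature :: "real set \<Rightarrow> (real \<Rightarrow> real) \<Rightarrow> real \<Rightarrow> real" where
  "frenet_curvature I \<theta> s = vector_derivative \<theta> (at s within I)"

lemma smooth_on_const: "smooth_on UNIV (\<lambda>_::plane. c::plane)"
proof -
  have "Ck_on k UNIV (\<lambda>_::plane. c::plane)" for k
    by (induction k arbitrary: c) (auto simp: frechet_derivative_const)
  then show ?thesis by (simp add: smooth_on_def)
qed

lemma cl_connection_unique:
  assumes "cl_connection nabla W m n" "cl_connection nabla W' m' n'"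
  shows "m p *\<^sub>R W = m' p *\<^sub>R W'" "n p *\<^sub>R W = n' p *\<^sub>R W'"
proof -
  have E: "(m p * (W \<bullet> b)) *\<^sub>R a + (n p * (a \<bullet> b)) *\<^sub>R W = (m' p * (W' \<bullet> b)) *\<^sub>R a + (n' p * (a \<bullet> b)) *\<^sub>R W'" for a b
    using assms[unfolded cl_connection_def] smooth_on_const[of a] smooth_on_const[of b]
    by (smt (verit) add.assoc add_left_cancel)
  note e1 = E[of "axis 1 1" "axis 1 1"] and e2 = E[of "axis 2 1" "axis 2 1"]
  show n: "n p *\<^sub>R W = n' p *\<^sub>R W'"
    using e1 e2 by (auto simp: vec_eq_iff forall_2 inner_vec_def sum_2 axis_def)
  show "m p *\<^sub>R W = m' p *\<^sub>R W'"
    using e1 e2 n by (auto simp: vec_eq_iff forall_2 inner_vec_def sum_2 axis_def)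
qed

(* The triple (W, m, n) is not determined by the connection: (-W, -m, -n) gives the same one.
   By cl_connection_unique the fields m W and n W are determined by it, and the two curvatures
   depend on (W, m, n) only through these, so the descriptions below are unique. *)
definition tangential_curvature ::
    "(vfield \<Rightarrow> vfield \<Rightarrow> vfield) \<Rightarrow> real set \<Rightarrow> (real \<Rightarrow> plane) \<Rightarrow> real \<Rightarrow> real" where
  "tangential_curvature nabla I \<gamma> s =
     (THE k. \<exists>W m n. cl_connection nabla W m n \<and>
        k = (m (\<gamma> s) + n (\<gamma> s)) * (W \<bullet> tangent I \<gamma> s))"

definition geodesic_curvature ::
    "(vfield \<Rightarrow> vfield \<Rightarrow> vfield) \<Rightarrow> real set \<Rightarrow> (real \<Rightarrow> plane) \<Rightarrow> (real \<Rightarrow> real) \<Rightarrow> real \<Rightarrow> real" where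
  "geodesic_curvature nabla I \<gamma> \<theta> s =
     (THE k. k \<ge> 0 \<and> (\<exists>W m n. cl_connection nabla W m n \<and>
        k\<^sup>2 = (frenet_curvature I \<theta> s + n (\<gamma> s) * (W \<bullet> normal \<theta> s))\<^sup>2
            + (m (\<gamma> s) * (W \<bullet> normal \<theta> s) - frenet_curvature I \<theta> s)\<^sup>2))"

definition relative_angle :: "(real \<Rightarrow> real) \<Rightarrow> real \<Rightarrow> real \<Rightarrow> real" where
  "relative_angle \<theta> \<theta>\<^sub>0 s = \<theta> s - \<theta>\<^sub>0"

end

theory Submission
  imports Defs
begin

text \<open>
  The two curvatures are defined by definite descriptions that range over all triples
  \<open>(W, m, n)\<close> representing the connection, so a formula in terms of one given triple first needs
  independence of the representation.  The connection determines the vector fields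
  \<open>m W\<close> and \<open>n W\<close> (\<open>cl_connection_unique\<close>), hence also every product
  \<open>m \<langle>W, v\<rangle>\<close> and \<open>n \<langle>W, v\<rangle>\<close>, and \<open>W\<close>, \<open>m\<close> and \<open>n\<close> enter the curvatures through such
  products only.  Therefore both curvatures can be computed from the given triple
  (\<open>tangential_curvature_eq\<close>, \<open>geodesic_curvature_eq\<close>).

  What remains is trigonometry: with \<open>T = (cos \<theta>, sin \<theta>)\<close> and \<open>N = (- sin \<theta>, cos \<theta>)\<close> the
  subtraction formulas give \<open>\<langle>W, T\<rangle> = cos \<psi>\<close> and \<open>\<langle>W, N\<rangle> = - sin \<psi>\<close>, while
  \<open>\<psi>' = \<theta>' = \<kappa>\<close> because the two angles differ by a constant.
\<close>

text \<open>
  The sign ambiguity between \<open>(W, m, n)\<close> and \<open>(- W, - m, - n)\<close> cancels in these products.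
\<close>

lemma cl_connection_products_unique:
  assumes "cl_connection nabla W m n" "cl_connection nabla W' m' n'"
  shows "m p * (W \<bullet> v) = m' p * (W' \<bullet> v)" "n p * (W \<bullet> v) = n' p * (W' \<bullet> v)"
  using cl_connection_unique[OF assms, of p] by (metis inner_scaleR_left)+

lemma tangential_curvature_eq:
  assumes "cl_connection nabla W m n"
  shows "tangential_curvature nabla I \<gamma> s = (m (\<gamma> s) + n (\<gamma> s)) * (W \<bullet> tangent I \<gamma> s)"
  unfolding tangential_curvature_def
proof (rule the_equality)
  show "\<exists>W' m' n'. cl_connection nabla W' m' n' \<and>
      (m (\<gamma> s) + n (\<gamma> s)) * (W \<bullet> tangent I \<gamma> s)
        = (m' (\<gamma> s) + n' (\<gamma> s)) * (W' \<bullet> tangent I \<gamma> s)"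
    using assms by blast
next
  fix k
  assume "\<exists>W' m' n'. cl_connection nabla W' m' n' \<and>
      k = (m' (\<gamma> s) + n' (\<gamma> s)) * (W' \<bullet> tangent I \<gamma> s)"
  then obtain W' m' n' where "cl_connection nabla W' m' n'"
    and "k = (m' (\<gamma> s) + n' (\<gamma> s)) * (W' \<bullet> tangent I \<gamma> s)"
    by blast
  then show "k = (m (\<gamma> s) + n (\<gamma> s)) * (W \<bullet> tangent I \<gamma> s)"
    using cl_connection_products_unique[OF assms, of W' m' n' "\<gamma> s" "tangent I \<gamma> s"]
    by (simp add: distrib_right)
qed

lemma geodesic_curvature_eq:
  assumes "cl_connection nabla W m n"
  shows "geodesic_curvature nabla I \<gamma> \<theta> s =
    sqrt ((frenet_curvature I \<theta> s + n (\<gamma> s) * (W \<bullet> normal \<theta> s))\<^sup>2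
        + (m (\<gamma> s) * (W \<bullet> normal \<theta> s) - frenet_curvature I \<theta> s)\<^sup>2)" (is "_ = sqrt ?q")
  unfolding geodesic_curvature_def
proof (rule the_equality)
  have "sqrt ?q \<ge> 0" "(sqrt ?q)\<^sup>2 = ?q"
    by simp_all
  then show "sqrt ?q \<ge> 0 \<and> (\<exists>W' m' n'. cl_connection nabla W' m' n' \<and>
      (sqrt ?q)\<^sup>2 = (frenet_curvature I \<theta> s + n' (\<gamma> s) * (W' \<bullet> normal \<theta> s))\<^sup>2
        + (m' (\<gamma> s) * (W' \<bullet> normal \<theta> s) - frenet_curvature I \<theta> s)\<^sup>2)"
    using assms by blast
next
  fix k :: real
  assume k: "k \<ge> 0 \<and> (\<exists>W' m' n'. cl_connection nabla W' m' n' \<and>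
      k\<^sup>2 = (frenet_curvature I \<theta> s + n' (\<gamma> s) * (W' \<bullet> normal \<theta> s))\<^sup>2
        + (m' (\<gamma> s) * (W' \<bullet> normal \<theta> s) - frenet_curvature I \<theta> s)\<^sup>2)"
  then obtain W' m' n' where "cl_connection nabla W' m' n'"
    and "k\<^sup>2 = (frenet_curvature I \<theta> s + n' (\<gamma> s) * (W' \<bullet> normal \<theta> s))\<^sup>2
        + (m' (\<gamma> s) * (W' \<bullet> normal \<theta> s) - frenet_curvature I \<theta> s)\<^sup>2"
    by blast
  then have "k\<^sup>2 = ?q"
    using cl_connection_products_unique[OF assms, of W' m' n' "\<gamma> s" "normal \<theta> s"] by simp
  then show "k = sqrt ?q"
    using k by (metis real_sqrt_unique)
qed

lemma inner_unit_tangent: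
  "(vector [cos \<theta>\<^sub>0, sin \<theta>\<^sub>0] :: real^2) \<bullet> vector [cos t, sin t] = cos (t - \<theta>\<^sub>0)"
  by (simp add: inner_vec_def sum_2 cos_diff)

lemma inner_normal:
  "(vector [cos \<theta>\<^sub>0, sin \<theta>\<^sub>0] :: real^2) \<bullet> normal \<theta> s = - sin (\<theta> s - \<theta>\<^sub>0)"
  by (simp add: normal_def inner_vec_def sum_2 sin_diff)

text \<open>
  Subtracting a constant does not change whether a number is a derivative within a set, and
  \<^const>\<open>vector_derivative\<close> depends on this predicate only, so the chosen values agree.
\<close>

lemma vector_derivative_relative_angle:
  "vector_derivative (relative_angle \<theta> \<theta>\<^sub>0) (at s within I) = frenet_curvature I \<theta> s"
proof -
  have "(relative_angle \<theta> \<theta>\<^sub>0 has_vector_derivative d) (at s within I)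
      \<longleftrightarrow> (\<theta> has_vector_derivative d) (at s within I)" for d
    using has_vector_derivative_diff_const[of \<theta> \<theta>\<^sub>0 d "at s within I"]
    by (simp add: relative_angle_def[abs_def])
  then show ?thesis
    by (simp add: frenet_curvature_def vector_derivative_def)
qed

theorem theorem4p8:
  fixes nabla :: "vfield \<Rightarrow> vfield \<Rightarrow> vfield"
    and W :: "real^2" and m n :: "real^2 \<Rightarrow> real" and \<theta>\<^sub>0 :: real
    and I :: "real set" and \<gamma> :: "real \<Rightarrow> real^2" and \<theta> \<psi> :: "real \<Rightarrow> real"
  assumes "cl_connection nabla W m n"
    and "W = vector [cos \<theta>\<^sub>0, sin \<theta>\<^sub>0]"
    and "is_interval I" and "interior I \<noteq> {}"
    and "arc_length_curve I \<gamma>"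
    and "angle_function I \<gamma> \<theta>"
    and "\<psi> = relative_angle \<theta> \<theta>\<^sub>0"
  shows "\<forall>s\<in>I.
      tangential_curvature nabla I \<gamma> s = (m (\<gamma> s) + n (\<gamma> s)) * cos (\<psi> s) \<and>
      geodesic_curvature nabla I \<gamma> \<theta> s =
        sqrt ((vector_derivative \<psi> (at s within I) - n (\<gamma> s) * sin (\<psi> s))\<^sup>2
            + (vector_derivative \<psi> (at s within I) + m (\<gamma> s) * sin (\<psi> s))\<^sup>2)"
proof
  fix s
  assume "s \<in> I"
  then have T: "tangent I \<gamma> s = vector [cos (\<theta> s), sin (\<theta> s)]"
    using assms(6) by (simp add: angle_function_def)
  have \<psi>: "\<psi> s = \<theta> s - \<theta>\<^sub>0"
    using assms(7) by (simp add: relative_angle_def)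
  have \<kappa>: "frenet_curvature I \<theta> s = vector_derivative \<psi> (at s within I)"
    using assms(7) by (simp add: vector_derivative_relative_angle)
  have "tangential_curvature nabla I \<gamma> s = (m (\<gamma> s) + n (\<gamma> s)) * cos (\<psi> s)"
    unfolding tangential_curvature_eq[OF assms(1)] T \<psi> assms(2) inner_unit_tangent ..
  moreover have "geodesic_curvature nabla I \<gamma> \<theta> s =
        sqrt ((vector_derivative \<psi> (at s within I) - n (\<gamma> s) * sin (\<psi> s))\<^sup>2
            + (- m (\<gamma> s) * sin (\<psi> s) - vector_derivative \<psi> (at s within I))\<^sup>2)"
    unfolding geodesic_curvature_eq[OF assms(1)] \<kappa> \<psi> assms(2) inner_normal by simp
  moreover have "(- m (\<gamma> s) * sin (\<psi> s) - vector_derivative \<psi> (at s within I))\<^sup>2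
      = (vector_derivative \<psi> (at s within I) + m (\<gamma> s) * sin (\<psi> s))\<^sup>2"
    by (simp add: power2_eq_square algebra_simps)
  ultimately show "tangential_curvature nabla I \<gamma> s = (m (\<gamma> s) + n (\<gamma> s)) * cos (\<psi> s) \<and>
      geodesic_curvature nabla I \<gamma> \<theta> s =
        sqrt ((vector_derivative \<psi> (at s within I) - n (\<gamma> s) * sin (\<psi> s))\<^sup>2
            + (vector_derivative \<psi> (at s within I) + m (\<gamma> s) * sin (\<psi> s))\<^sup>2)"
    by simp
qed

end
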